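(* Let $(X,\tau)$ be a Hausdorff topological space, let $k$ be a positive integer, and let $\Phi,\Psi:X\to\,]-\infty,+\infty]$ be two functions. Assume that there is a real number $\rho>\inf_X\Psi$ such that the set $\overline{\Psi^{-1}(]-\infty,\rho[)}$ is compact and sequentially compact, has at least $k$ connected components, and each of its connected components intersects the interior of $\mathrm{dom}(\Phi)$. Moreover, suppose that $\Phi$ is bounded below in $\overline{\Psi^{-1}(]-\infty,\rho[)}$ and that the function $\Psi+\lambda\Phi$ is sequentially lower semicontinuous for each $\lambda>0$ small enough. Then there exists $\lambda^*>0$ such that, for each $\lambda\in\,]0,\lambda^*[$, the function $\Psi+\lambda\Phi$ has at least $k$ $\tau_\Psi$-local minima lying in $\mathrm{dom}(\Phi)\cap\Psi^{-1}(]-\infty,\rho[)$.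
   Context: Closure, interior, compactness, sequential compactness, connectedness and sequential lower semicontinuity are with respect to $\tau$. For $\Phi:X\to\,]-\infty,+\infty]$, $\mathrm{dom}(\Phi)=\{x\in X:\Phi(x)<+\infty\}$. For $\Psi:X\to\,]-\infty,+\infty]$ with $\mathrm{dom}(\Psi)\neq\emptyset$, $\tau_\Psi$ denotes the smallest topology on $X$ containing both $\tau$ and the family of sets $\{\Psi^{-1}(]-\infty,r[)\}_{r\in\mathbf R}$. A $\tau_\Psi$-local minimum of a function $F$ on $X$ is a point $x\in X$ such that $F(x)\le F(y)$ for all $y$ in some $\tau_\Psi$-neighbourhood of $x$. "For each $\lambda>0$ small enough" means: there is $\lambda'>0$ such that the property holds for all $\lambda\in\,]0,\lambda']$. *)

theory Defs
  imports "HOL-Analysis.Analysis"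
begin

definition effective_domain :: "('a \<Rightarrow> ereal) \<Rightarrow> 'a set" where
  "effective_domain \<Phi> = {x. \<Phi> x < \<infinity>}"

(* For functions that never take the value -\<infinity>, this is the preimage of the open ray ]-\<infinity>, r[. *)
definition strict_sublevel :: "('a \<Rightarrow> ereal) \<Rightarrow> real \<Rightarrow> 'a set" where
  "strict_sublevel \<Psi> r = {x. \<Psi> x < ereal r}"

(* The carrier is the whole type, because UNIV is among the generating sets. *)
definition refined_topology :: "('a::topological_space \<Rightarrow> ereal) \<Rightarrow> 'a topology" where
  "refined_topology \<Psi> =
     topology_generated_by ({U. open U} \<union> range (strict_sublevel \<Psi>))"

definition local_minimum_in :: "'a topology \<Rightarrow> ('a \<Rightarrow> ereal) \<Rightarrow> 'a \<Rightarrow> bool" where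
  "local_minimum_in T F x \<longleftrightarrow> (\<exists>U. openin T U \<and> x \<in> U \<and> (\<forall>y\<in>U. F x \<le> F y))"

definition seq_lower_semicontinuous :: "('a::topological_space \<Rightarrow> ereal) \<Rightarrow> bool" where
  "seq_lower_semicontinuous F \<longleftrightarrow>
     (\<forall>s x. s \<longlonglongrightarrow> x \<longrightarrow> F x \<le> liminf (\<lambda>n. F (s n)))"

(* Not rendered as k \<le> card A, since card is 0 on infinite sets. *)
definition has_at_least :: "nat \<Rightarrow> 'b set \<Rightarrow> bool" where
  "has_at_least k A \<longleftrightarrow> (\<exists>B\<subseteq>A. finite B \<and> card B = k)"

end

theory Submission
  imports Defs
begin

text \<open>
  Write \<open>K\<close> for the closure of the strict sublevel set \<open>S = {x. \<Psi> x < \<rho>}\<close>. In a compact Hausdorff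
  space connected components coincide with quasi-components, so any \<open>k\<close> components of \<open>K\<close> can be
  enclosed in \<open>k\<close> pairwise disjoint clopen subsets of \<open>K\<close> (\<open>quasi_components_clopen_separation\<close>).
  Clopenness makes these pieces much better than the components themselves: a piece \<open>V\<close> is the
  trace on \<open>K\<close> of an open set, and it meets the interior of \<open>dom \<Phi>\<close>, so density of \<open>S\<close> in \<open>K\<close>
  gives a point \<open>y \<in> V \<inter> S\<close> with \<open>\<Phi> y < \<infinity>\<close>.

  The function \<open>\<Psi> + \<lambda> \<Phi>\<close> attains its minimum over \<open>V\<close> at some point \<open>x\<close>, since \<open>V\<close> is sequentially
  compact. Comparing \<open>x\<close> with \<open>y\<close>, and using a lower bound \<open>m\<close> of \<open>\<Phi>\<close> on \<open>K\<close>, gives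
  \<open>\<Psi> x \<le> \<Psi> y + \<lambda> (\<Phi> y - m)\<close>, which is below \<open>\<rho>\<close> once \<open>\<lambda>\<close> is small
  (\<open>minimiser_in_sublevel\<close>). So the minimiser lies in \<open>V \<inter> S\<close>, which is open in the refined topology
  because \<open>V\<close> is open in \<open>K\<close> and \<open>S \<subseteq> K\<close>; hence \<open>x\<close> is a local minimum there
  (\<open>local_minimum_on_clopen_piece\<close>). The number of pieces is finite, so one threshold for
  \<open>\<lambda>\<close> serves them all, and disjointness of the pieces makes the \<open>k\<close> minima distinct.
\<close>

text \<open>
  A quasi-component is cut off from each other one by a clopen set. For finitely many of them, the
  intersection of the clopen sets containing \<open>C\<close> and of the complements of those containing the other
  members is again clopen; two such intersections lie on opposite sides of a common clopen set.
\<close>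

lemma quasi_components_clopen_separation:
  assumes "finite \<B>" and sub: "\<B> \<subseteq> quasi_components_of X"
  obtains Q where "\<And>C. C \<in> \<B> \<Longrightarrow> openin X (Q C) \<and> closedin X (Q C) \<and> C \<subseteq> Q C"
    and "\<And>C D. C \<in> \<B> \<Longrightarrow> D \<in> \<B> \<Longrightarrow> C \<noteq> D \<Longrightarrow> Q C \<inter> Q D = {}"
proof -
  have "\<exists>T. openin X T \<and> closedin X T \<and> C \<subseteq> T \<and> T \<inter> D = {}"
    if "C \<in> \<B>" "D \<in> \<B>" "C \<noteq> D" for C D
  proof -
    have "separated_between X C D"
      using that sub separated_between_quasi_components[of C X D] pairwise_disjoint_quasi_components_of
      by (metis pairwiseD subsetD)
    then obtain U where "closedin X U" "openin X U" "C \<subseteq> U" "D \<subseteq> topspace X - U"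
      unfolding separated_between by blast
    then show ?thesis by blast
  qed
  then obtain T where T: "\<And>C D. C \<in> \<B> \<Longrightarrow> D \<in> \<B> \<Longrightarrow> C \<noteq> D \<Longrightarrow>
      openin X (T C D) \<and> closedin X (T C D) \<and> C \<subseteq> T C D \<and> T C D \<inter> D = {}"
    by metis
  \<comment> \<open>Intersecting with the whole space covers the case where \<open>C\<close> is the only member.\<close>
  define Q where "Q C = (\<Inter>D\<in>\<B> - {C}. T C D - T D C) \<inter> topspace X" for C
  show thesis
  proof
    fix C assume C: "C \<in> \<B>"
    have op: "openin X (T C D - T D C)" and cl: "closedin X (T C D - T D C)"
      if "D \<in> \<B> - {C}" for D
      using T[OF C] T[of D C] C that by (blast intro: openin_diff closedin_diff)+
    have "openin X (Q C)"
      unfolding Q_def using op assms(1) by (intro openin_INT) auto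
    moreover have "closedin X (Q C)"
    proof -
      have "Q C = \<Inter>(insert (topspace X) ((\<lambda>D. T C D - T D C) ` (\<B> - {C})))"
        unfolding Q_def by auto
      then show ?thesis
        using cl by (simp only:) (rule closedin_Inter, auto simp del: Inter_insert)
    qed
    moreover have "C \<subseteq> Q C"
    proof -
      have "C \<subseteq> T C D - T D C" if "D \<in> \<B> - {C}" for D
        using T[of C D] T[of D C] C that by blast
      moreover have "C \<subseteq> topspace X"
        using C sub quasi_components_of_subset by blast
      ultimately show ?thesis
        unfolding Q_def by (intro Int_greatest INT_greatest)
    qed
    ultimately show "openin X (Q C) \<and> closedin X (Q C) \<and> C \<subseteq> Q C" by blast
  next
    fix C D assume "C \<in> \<B>" "D \<in> \<B>" "C \<noteq> D"
    then show "Q C \<inter> Q D = {}"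
      unfolding Q_def by blast
  qed
qed

lemma components_eq_connected_components_of:
  "components S = connected_components_of (top_of_set S)"
proof -
  have "connected_component_set S x = connected_component_of_set (top_of_set S) x" for x
    unfolding connected_component_def connected_component_of_def connectedin_subtopology
      connectedin_iff_connected by (simp only: conj_assoc)
  then show ?thesis
    by (simp add: components_def connected_components_of_def)
qed

lemma seq_lower_semicontinuous_attains_inf:
  assumes "seq_compact V" "V \<noteq> {}" and lsc: "seq_lower_semicontinuous F"
  obtains x where "x \<in> V" "\<And>z. z \<in> V \<Longrightarrow> F x \<le> F z"
proof -
  obtain u where u: "\<And>n. u n \<in> F ` V" "u \<longlonglongrightarrow> Inf (F ` V)"
    using Inf_as_limit[of "F ` V"] assms(2) by auto
  then have "\<forall>n. \<exists>v\<in>V. u n = F v" by blast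
  then obtain s where s: "\<And>n. s n \<in> V" "\<And>n. u n = F (s n)"
    by metis
  from s(1) have "\<forall>n. s n \<in> V" by blast
  then obtain x r where x: "x \<in> V" "strict_mono r" "(s \<circ> r) \<longlonglongrightarrow> x"
    by (rule seq_compactE[OF assms(1)])
  have "(\<lambda>n. F ((s \<circ> r) n)) \<longlonglongrightarrow> Inf (F ` V)"
    using LIMSEQ_subseq_LIMSEQ[OF u(2) x(2)] s(2) by (simp add: o_def)
  then have "F x \<le> Inf (F ` V)"
    using lsc x(3) unfolding seq_lower_semicontinuous_def
    by (metis lim_imp_Liminf sequentially_bot)
  then show thesis
    using x(1) that[of x] by (auto intro: INF_lower2 simp: le_INF_iff)
qed

text \<open>
  The value at \<open>y\<close> is finite, and this is what prevents \<open>\<Phi>\<close> from being infinite at \<open>x\<close>.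
  The last hypothesis holds for all small \<open>l > 0\<close> as soon as \<open>\<Psi> y < \<rho>\<close>.
\<close>

lemma minimiser_in_sublevel:
  fixes \<Phi> \<Psi> :: "'a \<Rightarrow> ereal" and l m p q \<rho> :: real
  assumes "l > 0" "\<Psi> x > -\<infinity>" "ereal m \<le> \<Phi> x"
    and min: "\<Psi> x + ereal l * \<Phi> x \<le> \<Psi> y + ereal l * \<Phi> y"
    and "\<Psi> y = ereal q" "\<Phi> y = ereal p" "q + l * (p - m) < \<rho>"
  shows "\<Psi> x < ereal \<rho>" "\<Phi> x < \<infinity>"
proof -
  have fin: "\<Psi> x + ereal l * \<Phi> x \<le> ereal (q + l * p)"
    using min assms(5,6) by simp
  show "\<Phi> x < \<infinity>"
    using fin assms(1,2) by (cases "\<Phi> x"; cases "\<Psi> x") auto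
  then obtain f where f: "\<Phi> x = ereal f" "m \<le> f"
    using assms(3) by (cases "\<Phi> x") auto
  obtain g where g: "\<Psi> x = ereal g"
    using fin f assms(2) by (cases "\<Psi> x") auto
  have "g + l * f \<le> q + l * p" using fin f g by simp
  moreover have "l * m \<le> l * f" using f(2) assms(1) by simp
  ultimately have "g < \<rho>" using assms(7) by (simp add: algebra_simps)
  then show "\<Psi> x < ereal \<rho>" using g by simp
qed

lemma openin_refined_topology_Int_sublevel:
  "open U \<Longrightarrow> openin (refined_topology \<Psi>) (U \<inter> strict_sublevel \<Psi> r)"
  unfolding refined_topology_def
  by (intro openin_Int topology_generated_by_Basis) auto

text \<open>
  The point \<open>y\<close> is only used for comparison; it can be chosen before \<open>l\<close>, which is what makes a
  threshold for \<open>l\<close> possible.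
\<close>

lemma local_minimum_on_clopen_piece:
  fixes \<Phi> \<Psi> :: "'a::t2_space \<Rightarrow> ereal" and l m p q \<rho> :: real
  defines "K \<equiv> closure (strict_sublevel \<Psi> \<rho>)"
  assumes "seq_compact K" and V: "openin (top_of_set K) V" "closedin (top_of_set K) V"
    and "\<And>x. \<Psi> x > -\<infinity>" "\<And>x. x \<in> K \<Longrightarrow> ereal m \<le> \<Phi> x"
    and "seq_lower_semicontinuous (\<lambda>x. \<Psi> x + ereal l * \<Phi> x)" "l > 0"
    and y: "y \<in> V" "\<Psi> y = ereal q" "\<Phi> y = ereal p" "q + l * (p - m) < \<rho>"
  shows "\<exists>x\<in>V. x \<in> effective_domain \<Phi> \<inter> strict_sublevel \<Psi> \<rho> \<and>
           local_minimum_in (refined_topology \<Psi>) (\<lambda>x. \<Psi> x + ereal l * \<Phi> x) x"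
proof -
  have VK: "V \<subseteq> K" using V(1) openin_imp_subset by blast
  have "closed V" using V(2) closedin_closed_trans unfolding K_def by blast
  then have "seq_compact V"
    using seq_compact_Int_closed[OF assms(2)] VK by (metis inf.absorb2)
  then obtain x where x: "x \<in> V"
      and min: "\<And>z. z \<in> V \<Longrightarrow> \<Psi> x + ereal l * \<Phi> x \<le> \<Psi> z + ereal l * \<Phi> z"
    using seq_lower_semicontinuous_attains_inf[OF _ _ assms(7), of V] y(1) by blast
  have sub: "\<Psi> x < ereal \<rho>" "\<Phi> x < \<infinity>"
    using minimiser_in_sublevel[OF \<open>l > 0\<close> assms(5) _ min[OF y(1)] y(2-4)] assms(6) x VK by blast+
  obtain U where U: "open U" "V = K \<inter> U" using V(1) unfolding openin_open by blast
  have "U \<inter> strict_sublevel \<Psi> \<rho> \<subseteq> V"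
    using U(2) closure_subset unfolding K_def by blast
  moreover have "x \<in> U \<inter> strict_sublevel \<Psi> \<rho>"
    using x U(2) sub(1) by (simp add: strict_sublevel_def)
  ultimately have "local_minimum_in (refined_topology \<Psi>) (\<lambda>x. \<Psi> x + ereal l * \<Phi> x) x"
    unfolding local_minimum_in_def
    using openin_refined_topology_Int_sublevel[OF U(1)] min by blast
  moreover have "x \<in> effective_domain \<Phi> \<inter> strict_sublevel \<Psi> \<rho>"
    using sub unfolding effective_domain_def strict_sublevel_def by blast
  ultimately show ?thesis
    using x by blast
qed

lemma open_piece_meets_sublevel_and_domain:
  assumes V: "openin (top_of_set (closure (strict_sublevel \<Psi> r))) V"
    and "V \<inter> interior (effective_domain \<Phi>) \<noteq> {}"
  obtains y where "y \<in> V" "\<Psi> y < ereal r" "\<Phi> y < \<infinity>"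
proof -
  let ?S = "strict_sublevel \<Psi> r"
  obtain U where U: "open U" "V = closure ?S \<inter> U"
    using V unfolding openin_open by blast
  then have "U \<inter> interior (effective_domain \<Phi>) \<inter> closure ?S \<noteq> {}"
    using assms(2) by blast
  then have "U \<inter> interior (effective_domain \<Phi>) \<inter> ?S \<noteq> {}"
    using U(1) open_Int_closure_eq_empty open_Int open_interior by metis
  then obtain y where "y \<in> U" "y \<in> effective_domain \<Phi>" "y \<in> ?S"
    using interior_subset by blast
  then show thesis
    using that[of y] U(2) closure_subset[of ?S]
    by (auto simp: effective_domain_def strict_sublevel_def)
qed

lemma has_at_least_of_disjoint_pieces:
  assumes "finite \<B>" "card \<B> = k"
    and disj: "\<And>C D. C \<in> \<B> \<Longrightarrow> D \<in> \<B> \<Longrightarrow> C \<noteq> D \<Longrightarrow> Q C \<inter> Q D = {}"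
    and "\<And>C. C \<in> \<B> \<Longrightarrow> \<exists>x\<in>Q C. x \<in> A"
  shows "has_at_least k A"
proof -
  obtain f where f: "\<And>C. C \<in> \<B> \<Longrightarrow> f C \<in> Q C \<and> f C \<in> A"
    using assms(4) by metis
  then have "inj_on f \<B>"
    using disj by (intro inj_onI) (metis disjoint_iff)
  then show ?thesis
    unfolding has_at_least_def using f assms(1,2)
    by (intro exI[of _ "f ` \<B>"]) (auto simp: card_image)
qed

theorem theorem1:
  fixes \<Phi> \<Psi> :: "'a::t2_space \<Rightarrow> ereal" and k :: nat and \<rho> :: real
  assumes "k \<ge> 1"
    and "\<And>x. \<Phi> x > -\<infinity>"
    and "\<And>x. \<Psi> x > -\<infinity>"
    and "ereal \<rho> > (INF x. \<Psi> x)"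
    and "compact (closure (strict_sublevel \<Psi> \<rho>))"
    and "seq_compact (closure (strict_sublevel \<Psi> \<rho>))"
    and "has_at_least k (components (closure (strict_sublevel \<Psi> \<rho>)))"
    and "\<And>C. C \<in> components (closure (strict_sublevel \<Psi> \<rho>)) \<Longrightarrow>
           C \<inter> interior (effective_domain \<Phi>) \<noteq> {}"
    and "\<exists>m::real. \<forall>x\<in>closure (strict_sublevel \<Psi> \<rho>). ereal m \<le> \<Phi> x"
    and "\<exists>l0::real. l0 > 0 \<and>
           (\<forall>l\<in>{0<..l0}. seq_lower_semicontinuous (\<lambda>x. \<Psi> x + ereal l * \<Phi> x))"
  shows "\<exists>l1::real. l1 > 0 \<and>
           (\<forall>l\<in>{0<..<l1}.
              has_at_least k
                {x \<in> effective_domain \<Phi> \<inter> strict_sublevel \<Psi> \<rho>.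
                   local_minimum_in (refined_topology \<Psi>) (\<lambda>x. \<Psi> x + ereal l * \<Phi> x) x})"
proof -
  let ?K = "closure (strict_sublevel \<Psi> \<rho>)"
  have "compact_space (top_of_set ?K)"
    using assms(5) by (simp add: compact_space_subtopology)
  moreover have "Hausdorff_space (top_of_set ?K)"
    by (rule Hausdorff_space_subtopology) (simp add: Hausdorff_space_def disjnt_def separation_t2)
  ultimately have quasi: "quasi_components_of (top_of_set ?K) = components ?K"
    using quasi_eq_connected_components_of components_eq_connected_components_of by blast
  obtain \<B> where \<B>: "\<B> \<subseteq> components ?K" "finite \<B>" "card \<B> = k"
    using assms(7) unfolding has_at_least_def by blast
  then have "\<B> \<subseteq> quasi_components_of (top_of_set ?K)"
    using quasi by simp
  then obtain Q where Q: "\<And>C. C \<in> \<B> \<Longrightarrow>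
        openin (top_of_set ?K) (Q C) \<and> closedin (top_of_set ?K) (Q C) \<and> C \<subseteq> Q C"
      and disj: "\<And>C D. C \<in> \<B> \<Longrightarrow> D \<in> \<B> \<Longrightarrow> C \<noteq> D \<Longrightarrow> Q C \<inter> Q D = {}"
    using quasi_components_clopen_separation[OF \<B>(2)] by blast
  obtain m where m: "\<And>x. x \<in> ?K \<Longrightarrow> ereal m \<le> \<Phi> x"
    using assms(9) by blast
  obtain l0 where l0: "l0 > 0"
      "\<And>l. l \<in> {0<..l0} \<Longrightarrow> seq_lower_semicontinuous (\<lambda>x. \<Psi> x + ereal l * \<Phi> x)"
    using assms(10) by blast
  let ?A = "\<lambda>l. {x \<in> effective_domain \<Phi> \<inter> strict_sublevel \<Psi> \<rho>.
              local_minimum_in (refined_topology \<Psi>) (\<lambda>x. \<Psi> x + ereal l * \<Phi> x) x}"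
  have "\<forall>\<^sub>F l in at_right 0. \<exists>x\<in>Q C. x \<in> ?A l" if C: "C \<in> \<B>" for C
  proof -
    have "Q C \<inter> interior (effective_domain \<Phi>) \<noteq> {}"
      using assms(8)[of C] \<B>(1) C Q[OF C] by blast
    then obtain y where y: "y \<in> Q C" "\<Psi> y < ereal \<rho>" "\<Phi> y < \<infinity>"
      using open_piece_meets_sublevel_and_domain Q[OF C] by blast
    obtain q where q: "\<Psi> y = ereal q" "q < \<rho>"
      using y(2) assms(3)[of y] by (cases "\<Psi> y") auto
    obtain p where p: "\<Phi> y = ereal p"
      using y(3) assms(2)[of y] by (cases "\<Phi> y") auto
    have "((\<lambda>l. q + l * (p - m)) \<longlongrightarrow> q + 0 * (p - m)) (at_right 0)"
      by (intro tendsto_intros)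
    then have "\<forall>\<^sub>F l in at_right 0. q + l * (p - m) < \<rho>"
      using q(2) by (intro order_tendstoD(2)) auto
    moreover have "\<forall>\<^sub>F l in at_right 0. l \<in> {0<..<l0}"
      using l0(1) by (rule eventually_at_right_real)
    ultimately show ?thesis
    proof eventually_elim
      case (elim l)
      then have "l > 0" "seq_lower_semicontinuous (\<lambda>x. \<Psi> x + ereal l * \<Phi> x)"
        using l0(2) by auto
      then show ?case
        using local_minimum_on_clopen_piece[where V = "Q C" and m = m, OF assms(6)]
          Q[OF C] assms(3) m y(1) q(1) p elim(1) by blast
    qed
  qed
  then have "\<forall>\<^sub>F l in at_right 0. \<forall>C\<in>\<B>. \<exists>x\<in>Q C. x \<in> ?A l"
    using \<B>(2) by (simp add: eventually_ball_finite_distrib)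
  then have "\<forall>\<^sub>F l in at_right 0. has_at_least k (?A l)"
    by eventually_elim (rule has_at_least_of_disjoint_pieces[OF \<B>(2,3) disj], auto)
  then show ?thesis
    unfolding eventually_at_right_field by auto
qed

end
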